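(* Let $\Xi$ be the $1|1$-dimensional contractible differential graded Frobenius algebra with basis consisting of the unit $1$ (even) and an odd element $a$, with $a^2=1$, $d(a)=1$, and odd symmetric bilinear form determined by $\langle a,1\rangle=1$. Then the cohomology class $$Q_\Xi\in\prod_{\chi=-1}^{-\infty}\left[\bigoplus_{g\ge0,\ n\ge1:\ \chi=2-2g-n}H^\bullet\big([\mathcal{K}\overline{\mathcal{M}}_{g,n}\times\Delta_n^\circ]^\infty/\mathbb{S}_n\big)\right]$$ (twisted coefficients, tensored with $\mathbb{R}[h]$) has a nontrivial component in every Euler characteristic; that is, for every integer $\chi\le-1$ the component of $Q_\Xi$ in the factor indexed by $\chi$ is nonzero.
   Context: Conventions. All vector spaces are $\mathbb{Z}/2$-graded over $\mathbb{R}$; $|x|$ is the parity of $x$, the Koszul sign rule is used, $\Pi$ is parity reversion. Symplectic vector spaces are finite-dimensional with a nondegenerate graded skew-symmetric homogeneous form. For a nondegenerate form, $D_l(u)=\langle u,-\rangle$, $D_r(u)=\langle -,u\rangle$, and the inverse form on $V^*$ is defined by $\langle-,-\rangle^{-1}\circ(D_l\otimes D_r)=\langle-,-\rangle$. A dg Lie algebra has an odd bracket $\{-,-\}$ and odd differential (equivalent by parity reversion to the usual notion). Its Chevalley–Eilenberg (CE) complex is $C_\bullet(\mathfrak{g})=S(\mathfrak{g})$, $\delta(g_1\cdots g_n)=\sum_{i<j}\pm\{g_i,g_j\}g_1\cdots\hat g_i\cdots\hat g_j\cdots g_n+\sum_i\pm d(g_i)g_1\cdots\hat g_i\cdots g_n$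 (Koszul signs); the relative complex is $C_\bullet(\mathfrak{g},\mathfrak{q})=S(\mathfrak{g}/\mathfrak{q})_{\mathfrak{q}}$, and cochains are linear maps on it. The dg Lie algebra $\Lambda_\gamma[V]$ for an even symplectic form. $\mathfrak{h}[V]=\bigoplus_{n\ge0}[(V^* )^{\otimes n}]_{\mathbb{Z}/n}$ (cyclic words), with even Lie bracket $$\{a_1\cdots a_n,b_1\cdots b_m\}=\sum_{i,j}(-1)^p\langle a_i,b_j\rangle^{-1}(z^{i-1}_{n-1}\cdot[a_1\cdots\hat a_i\cdots a_n])(z^{j-1}_{m-1}\cdot[b_1\cdots\hat b_j\cdots b_m]),$$ $z_n=(n\ n{-}1\ldots1)$ acting with Koszul signs, $p=|a_i|(|a_{i+1}|+\dots+|a_n|+|b_1|+\dots+|b_{j-1}|)$, and even cobracket $$\Delta(a_1\cdots a_n)=\tfrac12\sum_{i<j}(-1)^p\langle a_i,a_j\rangle^{-1}[1-(1\,2)]\cdot[(a_{i+1}\cdots a_{j-1})\otimes(a_{j+1}\cdots a_na_1\cdots a_{i-1})],$$ $p=(|a_1|+\dots+|a_{i-1}|)(|a_{i+1}|+\dots+|a_{j-1}|+|a_{j+1}|+\dots+|a_n|)+|a_j|(|a_{i+1}|+\dots+|a_{j-1}|)$. Via parity reversion $\Pi\mathfrak{h}[V]$ has an odd bracket and cobracket; $\mathfrak{l}=\mathbb{R}[\gamma]\otimes S(\Pi\mathfrak{h}[V])$ with Leibniz-extended bracket and $d=\gamma\cdot\delta+\Delta$ ($\delta$ the CE differential of the bracket,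 $\Delta$ the cobracket extended as a derivation) is a dg Lie algebra. Writing the empty word as an (odd) parameter $\nu$, $\mathfrak{l}=\mathbb{R}[\gamma,\nu]\otimes S(\Pi\mathfrak{h}_{\ge1}[V])$. Quotient by $\mathbb{R}[\gamma,\nu]$; give $\gamma$ order 2, $\nu$ order 1, a word of length $i$ order $i$; $\Lambda_{\gamma,\nu}[V]$ is the part of order $\ge2$, and $\Lambda_\gamma[V]$ is the quotient dg Lie algebra obtained by setting $\nu=0$. As a graded vector space $\Lambda_\gamma[V]$ is the subspace of $\Lambda_{\gamma,\nu}[V]$ of elements not involving $\nu$. For an odd symplectic form on $U$, $\Lambda_{\gamma,\nu}[U]$ has underlying space the order $\ge2$ part of $\mathbb{R}[\gamma,\nu]\otimes S_{\ge1}(\mathfrak{h}_{\ge1}[U])$, with $\nu$ even. Stable versions. $W^0_{2n|m}$ has even coordinates $p_i,q_i$ ($1\le i\le n$), odd coordinates $\xi_i$ ($1\le i\le m$) and even form $\sum_i(p_i\otimes q_i-q_i\otimes p_i)+\sum_i\xi_i\otimes\xi_i$. $\Lambda^0_\gamma=\varinjlim\Lambda_\gamma[W^0_{2n|m}]$, and $\mathfrak{osp}=\varinjlim\mathfrak{osp}[W^0_{2n|m}]$ is the subalgebra of cyclic words of length 2. $C_\bullet(\Lambda^0_\gamma,\mathfrak{osp})$ is a commutative cocommutative dg Hopf algebra (product from $W\oplus W'\subset W''$, coproduct the standard one on $S$); $\mathcal{P}H_\bullet(\Lambda^0_\gamma,\mathfrak{osp})$ denotes primitive homology. Moduli spaces.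 $\mathcal{K}\overline{\mathcal{M}}_{g,n}$ (Kontsevich compactification) is the quotient of the Deligne–Mumford space $\overline{\mathcal{M}}_{g,n}$ identifying two stable curves if, after contracting the irreducible components without marked points and labeling the resulting nodal singularities by their arithmetic genus, there is a biholomorphism preserving the labels. $\Delta_n^\circ$ is the open simplex of dimension $n-1$, $X^\infty$ is the one-point compactification, and $\mathbb{S}_n$ permutes marked points and simplex coordinates. A known theorem identifies $\mathcal{P}H_\bullet(\Lambda^0_\gamma,\mathfrak{osp})$ with $\bigoplus_{\chi\le-1}\bigoplus_{2-2g-n=\chi}H_\bullet([\mathcal{K}\overline{\mathcal{M}}_{g,n}\times\Delta_n^\circ]^\infty/\mathbb{S}_n)$ with twisted coefficients. The summand of Euler characteristic $\chi$ corresponds to the part of CE weight $-\chi$, where a term $\gamma^i[w_1\cdots w_c]$ with $c$ cyclic words of total length $l$ has weight $2i+c-2+\frac l2$ and weights add in products. A class in $H^\bullet(\Lambda^0_\gamma,\mathfrak{osp})$ with coefficients in $\mathbb{R}[h]$ thus determines, by restriction to primitive homology, an element of the product of cohomologies in the claim; its component of Euler characteristic $\chi$ is nonzero iff it defines a nonzero functional on the weight $-\chi$ part of $\mathcal{P}H_\bullet(\Lambda^0_\gamma,\mathfrak{osp})$. The class $Q_A$ for a dg Frobenius algebra $A$ with odd form. A dg Frobenius algebra is a finite-dimensional unital associative graded algebra with odd derivation $d$, $d^2=0$, and a nondegenerate graded-symmetric homogeneous form with $\langle ab,c\rangle=\langle a,bc\rangle$, $\langle da,b\rangle+(-1)^{|a|}\langle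 a,db\rangle=0$; contractible means $H(A,d)=0$. Write the inverse form as $x_i\otimes y^i$ (summation implied). Put $t_n(a_1,\dots,a_n)=\langle a_1\cdots a_{n-1},a_n\rangle$, $\beta(a)=x_iy^ia$, $\gamma(a)=(-1)^{|x_j||y^i|}x_ix_jy^iy^ja$. For $n\ge1$, $$\alpha_n^{0,0}[(a_{11}\cdots a_{1k_1})\otimes\cdots\otimes(a_{n1}\cdots a_{nk_n})]=(-1)^pt_n(x_{i_n},\dots,x_{i_1})\,t_{k_1+\dots+k_n+n}(y^{i_1},a_{11},\dots,a_{1k_1},\dots,y^{i_n},a_{n1},\dots,a_{nk_n})$$ with $p=\sum_{r=1}^{n-1}|y^{i_{r+1}}|(|a_{11}|+\dots+|a_{rk_r}|+r)$ (all letters of the first $r$ words), and $\alpha_n^{g,b}$ is obtained by applying $\beta^b\gamma^g$ to one letter. These are skew-symmetric in the $n$ words and cyclically invariant in each. For $V$ even symplectic, $V\otimes A$ has the odd symplectic form $(-1)^{|a_1||v_2|}\langle v_1,v_2\rangle_V\langle a_1,a_2\rangle_A$, and $\Phi_A:\Lambda_{\gamma,\nu}[V]\to\Lambda_{\gamma,\nu}[V\otimes A]$ sends $\gamma^g\nu^b[w_1\cdots w_n]$ (with $w_1\otimes\cdots\otimes w_n\in V^{*\otimes k_1}\otimes\cdots\otimes V^{*\otimes k_n}$, each $w_i$ regarded in $\Pi\mathfrak{h}[V]$) to $\gamma^g\nu^b$ times the product of cyclic words in $(V\otimes A)^*$ represented by $(w_1\otimes\cdots\otimes w_n)\otimes\alpha_n^{g,b}|_{[k_1,\dots,k_n]}$,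 with Koszul signs. $\mathrm{N}(\gamma^i\nu^j[(x_{11}\cdots x_{1k_1})\cdots(x_{n1}\cdots x_{nk_n})])=h^{2i+j+n-1}x_{11}\cdots x_{nk_n}\in\mathbb{R}[h,h^{-1}]\otimes S((V\otimes A)^* )$, $\mathrm{M}(p_1\otimes\cdots\otimes p_k)=h^{-k}p_1\cdots p_k$; $\Phi_A,\mathrm{N}$ extend multiplicatively to symmetric algebras. For contractible $A$ a Hodge decomposition is an odd $s:A\to A$ with $ds+sd=\mathrm{id}$, $s^2=0$, $\langle s(a),b\rangle=(-1)^{|a|}\langle a,s(b)\rangle$; $\tilde L=V\otimes\mathrm{Im}(s)$; $\sigma_d$ is the quadratic function corresponding (under $x\otimes y\mapsto x\otimes y+(-1)^{|x||y|}y\otimes x$) to the even symmetric form $(-1)^{|a_1|(|v_2|+1)}\langle v_1,v_2\rangle_V\langle a_1,d(a_2)\rangle_A$ on $V\otimes A$. Then $$Q_A(\mathbf{x}_1\cdots\mathbf{x}_k)=\frac{\int_{\tilde L}\mathrm{M}\mathrm{N}\Phi_A(\mathbf{x}_1\cdots\mathbf{x}_k)e^{-\sigma_d/h}}{\int_{\tilde L}e^{-\sigma_d/h}}\in\mathbb{R}[h],$$ where integrals of polynomials are computed in linear coordinates on $\tilde L$ diagonalizing $\sigma_d$, by Berezin integration over odd variables and Gaussian integration (Wick rotation for negative squares) over even ones. If the map $\beta$ vanishes (as it does for $A=\Xi$), the restriction of $Q_A$ to elements of $\Lambda_\gamma[V]\subset\Lambda_{\gamma,\nu}[V]$ is a cocycle;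 taking $V=W^0_{2n|m}$ and passing to the limit gives $Q_A\in C^\bullet(\Lambda^0_\gamma,\mathfrak{osp})$ with coefficients in $\mathbb{R}[h]$, whose class is independent of $s$. For $\Xi$, the canonical Hodge decomposition is $s(1)=a$, $s(a)=0$. *)

theory Defs
  imports "HOL-Analysis.Analysis" "HOL-Library.Poly_Mapping"
begin

section \<open>Free real vector spaces\<close>

text \<open>
  Tensor and symmetric powers are presented by generators and relations: the free real vector space
  on a set of monomials is the type of finitely supported functions, and every quotient that occurs
  below is taken by an explicitly given span.
\<close>

instantiation poly_mapping :: (type, real_vector) real_vector
begin

definition scaleR_poly_mapping :: "real \<Rightarrow> ('a \<Rightarrow>\<^sub>0 'b) \<Rightarrow> 'a \<Rightarrow>\<^sub>0 'b"
  where "scaleR_poly_mapping r p = Poly_Mapping.map (\<lambda>x. r *\<^sub>R x) p"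

lemma lookup_scaleR [simp]:
  "Poly_Mapping.lookup (r *\<^sub>R p) k = r *\<^sub>R Poly_Mapping.lookup (p :: 'a \<Rightarrow>\<^sub>0 'b) k"
  by (simp add: scaleR_poly_mapping_def map.rep_eq when_def)

instance
  by standard (auto intro!: poly_mapping_eqI simp: lookup_add algebra_simps)

end

abbreviation single1 :: "'a \<Rightarrow> 'a \<Rightarrow>\<^sub>0 real"
  where "single1 m \<equiv> Poly_Mapping.single m 1"

text \<open>The linear extension of a map given on basis elements.\<close>

definition lext :: "('a \<Rightarrow> 'b::real_vector) \<Rightarrow> ('a \<Rightarrow>\<^sub>0 real) \<Rightarrow> 'b"
  where "lext f x = (\<Sum>k\<in>Poly_Mapping.keys x. Poly_Mapping.lookup x k *\<^sub>R f k)"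

definition sg :: "nat \<Rightarrow> real"
  where "sg n = (- 1) ^ n"

definition omit1 :: "nat \<Rightarrow> 'a list \<Rightarrow> 'a list"
  where "omit1 i xs = take i xs @ drop (Suc i) xs"

definition omit2 :: "nat \<Rightarrow> nat \<Rightarrow> 'a list \<Rightarrow> 'a list"
  where "omit2 i j xs = take i xs @ drop (Suc i) (take j xs) @ drop (Suc j) xs"

definition parsum :: "('a \<Rightarrow> nat) \<Rightarrow> 'a list \<Rightarrow> nat"
  where "parsum par xs = (\<Sum>x\<leftarrow>xs. par x)"

text \<open>
  Koszul signs: \<open>front1\<close> is the sign of moving the entry at position \<open>i\<close> to the front,
  \<open>front2\<close> (for \<open>i < j\<close>) that of moving the entries at positions \<open>i\<close> and \<open>j\<close> to the front, in this
  order. All positions count from 0.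
\<close>

definition front1 :: "('a \<Rightarrow> nat) \<Rightarrow> nat \<Rightarrow> 'a list \<Rightarrow> real"
  where "front1 par i xs = sg (par (xs ! i) * parsum par (take i xs))"

definition front2 :: "('a \<Rightarrow> nat) \<Rightarrow> nat \<Rightarrow> nat \<Rightarrow> 'a list \<Rightarrow> real"
  where "front2 par i j xs =
    sg (par (xs ! i) * parsum par (take i xs)
      + par (xs ! j) * (parsum par (take i xs) + parsum par (drop (Suc i) (take j xs))))"


section \<open>The stable even symplectic vector space\<close>

text \<open>
  The coordinates on \<open>W\<^sup>0\<close>, i.e. a basis of the dual space. The space with coordinates indexed by
  all natural numbers stands for the union of the \<open>W n m\<close>: in these bases the maps of the direct
  systems are inclusions, and forming tensor powers, homology and coinvariants commutes with directed
  unions.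
\<close>

datatype coord = Cp nat | Cq nat | Cxi nat

fun cpar :: "coord \<Rightarrow> nat" where
  "cpar (Cp i) = 0"
| "cpar (Cq i) = 0"
| "cpar (Cxi i) = 1"

definition W :: "nat \<Rightarrow> nat \<Rightarrow> coord set"
  where "W n m = Cp ` {..<n} \<union> Cq ` {..<n} \<union> Cxi ` {..<m}"

text \<open>
  The form \<open>\<Sum>(p\<^sub>i \<otimes> q\<^sub>i - q\<^sub>i \<otimes> p\<^sub>i) + \<Sum>\<xi>\<^sub>i \<otimes> \<xi>\<^sub>i\<close>, evaluated as a function of two arguments on the basis
  of the space dual to the coordinates (and indexed by them).
\<close>

fun omega :: "coord \<Rightarrow> coord \<Rightarrow> real" where
  "omega (Cp i) (Cq j) = of_bool (i = j)"
| "omega (Cq i) (Cp j) = - of_bool (i = j)"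
| "omega (Cxi i) (Cxi j) = of_bool (i = j)"
| "omega _ _ = 0"

fun omega_inv :: "coord \<Rightarrow> coord \<Rightarrow> real" where
  "omega_inv (Cp i) (Cq j) = - of_bool (i = j)"
| "omega_inv (Cq i) (Cp j) = of_bool (i = j)"
| "omega_inv (Cxi i) (Cxi j) = of_bool (i = j)"
| "omega_inv _ _ = 0"

text \<open>
  This is the defining property of the inverse form: \<open>D\<^sub>l\<close> and \<open>D\<^sub>r\<close> are even here, and
  \<open>D\<^sub>l e\<^sub>a = \<Sum>\<^sub>c omega a c \<cdot> c\<close>, \<open>D\<^sub>r e\<^sub>b = \<Sum>\<^sub>d omega d b \<cdot> d\<close>.
\<close>

lemma omega_inv_inverse:
  assumes "a \<in> W n m" "b \<in> W n m"
  shows "(\<Sum>c\<in>W n m. \<Sum>d\<in>W n m. omega a c * omega d b * omega_inv c d) = omega a b"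
proof -
  have fin: "finite (W n m)" by (simp add: W_def)
  define pr where "pr = (\<lambda>c. case c of Cp i \<Rightarrow> Cq i | Cq i \<Rightarrow> Cp i | Cxi i \<Rightarrow> Cxi i)"
  have pr_in: "pr a \<in> W n m" "pr b \<in> W n m"
    using assms by (auto simp: W_def pr_def)
  have l: "omega a c = (if c = pr a then omega a (pr a) else 0)" for c
    by (cases a; cases c) (auto simp: pr_def)
  have r: "omega d b = (if d = pr b then omega (pr b) b else 0)" for d
    by (cases b; cases d) (auto simp: pr_def)
  have "(\<Sum>c\<in>W n m. \<Sum>d\<in>W n m. omega a c * omega d b * omega_inv c d)
      = (\<Sum>c\<in>W n m. if c = pr a then omega a (pr a) * omega (pr b) b * omega_inv c (pr b) else 0)"
  proof (rule sum.cong)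
    fix c
    have "(\<Sum>d\<in>W n m. omega a c * omega d b * omega_inv c d)
        = (\<Sum>d\<in>W n m. if d = pr b then omega a c * omega (pr b) b * omega_inv c (pr b) else 0)"
      by (rule sum.cong, simp, subst (1) r) auto
    also have "\<dots> = omega a c * omega (pr b) b * omega_inv c (pr b)"
      using fin pr_in by simp
    finally show "(\<Sum>d\<in>W n m. omega a c * omega d b * omega_inv c d)
        = (if c = pr a then omega a (pr a) * omega (pr b) b * omega_inv c (pr b) else 0)"
      by (simp add: l[of c])
  qed simp
  also have "\<dots> = omega a (pr a) * omega (pr b) b * omega_inv (pr a) (pr b)"
    using fin pr_in by simp
  also have "\<dots> = omega a b"
    by (cases a; cases b) (auto simp: pr_def)
  finally show ?thesis .
qed


section \<open>The dg Lie algebra\<close>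

text \<open>
  A list of coordinates represents a cyclic word (cyclic invariance is among the relations below);
  \<open>ppar\<close> is the parity of the word as an element of the parity reversion.
\<close>

type_synonym cword = "coord list"

abbreviation wpar :: "cword \<Rightarrow> nat"
  where "wpar \<equiv> parsum cpar"

definition ppar :: "cword \<Rightarrow> nat"
  where "ppar w = Suc (wpar w)"

text \<open>
  The even bracket. Removing the letter at position \<open>i\<close> and applying \<open>z\<^bsup>i-1\<^esup>\<close> (positions from 1 in
  this exponent) moves the letters in front of it to the end of the word.
\<close>

definition bracket_words :: "cword \<Rightarrow> cword \<Rightarrow> (cword \<Rightarrow>\<^sub>0 real)"
  where "bracket_words a b =
    (\<Sum>i<length a. \<Sum>j<length b.
      Poly_Mapping.single ((drop (Suc i) a @ take i a) @ (drop (Suc j) b @ take j b))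
       (sg (cpar (a ! i) * (wpar (drop (Suc i) a) + wpar (take j b)))
        * omega_inv (a ! i) (b ! j)
        * sg (wpar (take i a) * wpar (drop (Suc i) a))
        * sg (wpar (take j b) * wpar (drop (Suc j) b))))"

text \<open>The even cobracket; the transposition exchanges the two words with the Koszul sign.\<close>

definition cobracket_word :: "cword \<Rightarrow> (cword \<times> cword \<Rightarrow>\<^sub>0 real)"
  where "cobracket_word a =
    (\<Sum>j<length a. \<Sum>i<j.
      let u = drop (Suc i) (take j a);
          v = drop (Suc j) a @ take i a;
          c = sg (wpar (take i a) * (wpar u + wpar (drop (Suc j) a)) + cpar (a ! j) * wpar u)
              * omega_inv (a ! i) (a ! j)
      in (1 / 2) *\<^sub>R (Poly_Mapping.single (u, v) c
            - Poly_Mapping.single (v, u) (sg (wpar u * wpar v) * c)))"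

text \<open>
  Transport to the parity reversion: the parity reversion map \<open>\<Pi>\<close> intertwines the even operations
  with the odd ones, \<open>{-,-} \<circ> (\<Pi> \<otimes> \<Pi>) = \<Pi> \<circ> {-,-}\<close> and \<open>\<Delta> \<circ> \<Pi> = (\<Pi> \<otimes> \<Pi>) \<circ> \<Delta>\<close>. Here
  \<open>(\<Pi> \<otimes> \<Pi>)(x \<otimes> y) = (-1)\<^bsup>|x|\<^esup> \<Pi>x \<otimes> \<Pi>y\<close>. So \<open>{\<Pi>x,\<Pi>y} = (-1)\<^bsup>|x|\<^esup> \<Pi>{x,y}\<close>.
\<close>

definition odd_bracket_words :: "cword \<Rightarrow> cword \<Rightarrow> (cword \<Rightarrow>\<^sub>0 real)"
  where "odd_bracket_words a b = sg (wpar a) *\<^sub>R bracket_words a b"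

definition odd_cobracket_word :: "cword \<Rightarrow> (cword \<times> cword \<Rightarrow>\<^sub>0 real)"
  where "odd_cobracket_word a =
    lext (\<lambda>(u, v). sg (wpar u) *\<^sub>R single1 (u, v)) (cobracket_word a)"

text \<open>
  The monomial \<open>\<gamma>\<^sup>g w\<^sub>1 \<cdots> w\<^sub>c\<close> is the pair \<open>(g, [w\<^sub>1, \<dots>, w\<^sub>c])\<close>. The algebra \<open>\<Lambda>\<^sub>\<gamma>\<close> is spanned by the
  monomials of order at least 2 with at least one word and without the empty word \<open>\<nu>\<close>. The empty word
  is set to 0 and the scalars are divided out, so the operations drop (\<open>mono\<close>) every term in which an
  empty word or no word at all occurs.
\<close>

type_synonym lmon = "nat \<times> cword list"

fun lpar :: "lmon \<Rightarrow> nat"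
  where "lpar (g, ws) = parsum ppar ws"

fun mono :: "lmon \<Rightarrow> (lmon \<Rightarrow>\<^sub>0 real)"
  where "mono (g, ws) = (if ws \<noteq> [] \<and> [] \<notin> set ws then single1 (g, ws) else 0)"

fun in_Lambda :: "lmon \<Rightarrow> bool"
  where "in_Lambda (g, ws) \<longleftrightarrow>
    ws \<noteq> [] \<and> [] \<notin> set ws \<and> 2 * g + (\<Sum>w\<leftarrow>ws. length w) \<ge> 2"

text \<open>Leibniz extension of the odd bracket.\<close>

fun lie_bracket :: "lmon \<Rightarrow> lmon \<Rightarrow> (lmon \<Rightarrow>\<^sub>0 real)"
  where "lie_bracket (g, ws) (g', ws') =
    (\<Sum>i<length ws. \<Sum>j<length ws'.
      front2 ppar i (length ws + j) (ws @ ws') *\<^sub>R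
      lext (\<lambda>w. mono (g + g', w # omit2 i (length ws + j) (ws @ ws')))
        (odd_bracket_words (ws ! i) (ws' ! j)))"

text \<open>The differential \<open>d = \<gamma>\<cdot>\<delta> + \<Delta>\<close>.\<close>

fun lie_diff :: "lmon \<Rightarrow> (lmon \<Rightarrow>\<^sub>0 real)"
  where "lie_diff (g, ws) =
    (\<Sum>j<length ws. \<Sum>i<j.
      front2 ppar i j ws *\<^sub>R
      lext (\<lambda>w. mono (Suc g, w # omit2 i j ws)) (odd_bracket_words (ws ! i) (ws ! j)))
    + (\<Sum>i<length ws.
      front1 ppar i ws *\<^sub>R
      lext (\<lambda>(u, v). mono (g, u # v # omit1 i ws)) (odd_cobracket_word (ws ! i)))"


section \<open>The relative Chevalley-Eilenberg complex and its primitive homology\<close>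

text \<open>Monomials in \<open>S(\<Lambda>\<^sub>\<gamma>)\<close>; the empty list is the unit.\<close>

type_synonym cemon = "lmon list"

abbreviation cepar :: "cemon \<Rightarrow> nat"
  where "cepar \<equiv> parsum lpar"

definition ce_mons :: "cemon set"
  where "ce_mons = {m. \<forall>f\<in>set m. in_Lambda f}"

definition ce_diff :: "cemon \<Rightarrow> (cemon \<Rightarrow>\<^sub>0 real)"
  where "ce_diff m =
    (\<Sum>j<length m. \<Sum>i<j.
      front2 lpar i j m *\<^sub>R lext (\<lambda>f. single1 (f # omit2 i j m)) (lie_bracket (m ! i) (m ! j)))
    + (\<Sum>i<length m.
      front1 lpar i m *\<^sub>R lext (\<lambda>f. single1 (f # omit1 i m)) (lie_diff (m ! i)))"

text \<open>The odd operator \<open>{w,-}\<close> for a word \<open>w\<close> of length 2 (an element of \<open>osp\<close>), extended to \<open>S(\<Lambda>\<^sub>\<gamma>)\<close>.\<close>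

definition osp_action :: "cword \<Rightarrow> cemon \<Rightarrow> (cemon \<Rightarrow>\<^sub>0 real)"
  where "osp_action w m =
    (\<Sum>i<length m.
      front2 lpar 0 (Suc i) ((0, [w]) # m) *\<^sub>R
      lext (\<lambda>f. single1 (f # omit1 i m)) (lie_bracket (0, [w]) (m ! i)))"

text \<open>
  The relations cutting \<open>S(\<Lambda>\<^sub>\<gamma>/osp)\<^sub>o\<^sub>s\<^sub>p\<close> out of the free vector space: cyclic invariance of words,
  graded commutativity in \<open>S(\<Pi>h)\<close>, graded commutativity in \<open>S(\<Lambda>\<^sub>\<gamma>)\<close>, vanishing of \<open>osp\<close>, and
  \<open>osp\<close>-coinvariants.
\<close>

definition relators :: "(cemon \<Rightarrow>\<^sub>0 real) set"
  where "relators =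
    {single1 (X @ (g, A @ (x # w) # B) # Y)
        - sg (cpar x * wpar w) *\<^sub>R single1 (X @ (g, A @ (w @ [x]) # B) # Y) | X g A x w B Y.
        X @ (g, A @ (x # w) # B) # Y \<in> ce_mons}
  \<union> {single1 (X @ (g, A @ u # v # B) # Y)
        - sg (ppar u * ppar v) *\<^sub>R single1 (X @ (g, A @ v # u # B) # Y) | X g A u v B Y.
        X @ (g, A @ u # v # B) # Y \<in> ce_mons}
  \<union> {single1 (X @ f # f' # Y) - sg (lpar f * lpar f') *\<^sub>R single1 (X @ f' # f # Y) | X f f' Y.
        X @ f # f' # Y \<in> ce_mons}
  \<union> {single1 (X @ (0, [w]) # Y) | X w Y. length w = 2 \<and> X @ (0, [w]) # Y \<in> ce_mons}
  \<union> {osp_action w m | w m. length w = 2 \<and> m \<in> ce_mons}"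

definition relations :: "(cemon \<Rightarrow>\<^sub>0 real) set"
  where "relations = span relators"

text \<open>\<open>\<gamma>\<^sup>i w\<^sub>1 \<cdots> w\<^sub>c\<close> has weight \<open>2i + c - 2 + l/2\<close> where \<open>l\<close> is the total length.\<close>

definition ce_weight :: "cemon \<Rightarrow> real"
  where "ce_weight m =
    (\<Sum>(g, ws)\<leftarrow>m. 2 * real g + real (length ws) - 2 + real (\<Sum>w\<leftarrow>ws. length w) / 2)"

definition ce_chains :: "real \<Rightarrow> (cemon \<Rightarrow>\<^sub>0 real) set"
  where "ce_chains k = {x. Poly_Mapping.keys x \<subseteq> {m \<in> ce_mons. ce_weight m = k}}"

definition tens :: "('a \<Rightarrow>\<^sub>0 real) \<Rightarrow> ('a \<Rightarrow>\<^sub>0 real) \<Rightarrow> ('a \<times> 'a \<Rightarrow>\<^sub>0 real)"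
  where "tens x y = lext (\<lambda>m. lext (\<lambda>m'. single1 (m, m')) y) x"

text \<open>
  The standard (unshuffle) coproduct of a symmetric algebra; the sign is that of moving the factors
  with positions in \<open>I\<close> in front of the others.
\<close>

definition coprod :: "cemon \<Rightarrow> (cemon \<times> cemon \<Rightarrow>\<^sub>0 real)"
  where "coprod m =
    (\<Sum>I\<in>Pow {..<length m}.
      Poly_Mapping.single (nths m I, nths m (- I))
        (sg (\<Sum>j\<in>I. \<Sum>i\<in>{..<j} - I. lpar (m ! i) * lpar (m ! j))))"

definition tens_relations :: "(cemon \<times> cemon \<Rightarrow>\<^sub>0 real) set"
  where "tens_relations =
    span ({tens r (single1 m) | r m. r \<in> relations \<and> m \<in> ce_mons}
        \<union> {tens (single1 m) r | r m. r \<in> relations \<and> m \<in> ce_mons})"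

definition tens_diff :: "cemon \<times> cemon \<Rightarrow> (cemon \<times> cemon \<Rightarrow>\<^sub>0 real)"
  where "tens_diff = (\<lambda>(m, m').
    tens (ce_diff m) (single1 m') + sg (cepar m) *\<^sub>R tens (single1 m) (ce_diff m'))"

text \<open>
  Cycles, boundaries and primitivity of a homology class, each on representatives in the free vector
  space. By the Kuenneth theorem a class in the tensor square of homology vanishes iff it vanishes in
  the homology of the tensor square of the complex.
\<close>

definition ce_cycle :: "(cemon \<Rightarrow>\<^sub>0 real) \<Rightarrow> bool"
  where "ce_cycle x \<longleftrightarrow> lext ce_diff x \<in> relations"

definition null_homologous :: "(cemon \<Rightarrow>\<^sub>0 real) set"
  where "null_homologous = span (relators \<union> ce_diff ` ce_mons)"

definition primitive_class :: "(cemon \<Rightarrow>\<^sub>0 real) \<Rightarrow> bool"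
  where "primitive_class x \<longleftrightarrow>
    lext coprod x - tens x (single1 []) - tens (single1 []) x
      \<in> span (tens_relations \<union> tens_diff ` (ce_mons \<times> ce_mons))"

text \<open>The weight \<open>k\<close> part of \<open>\<P>H\<^sub>\<bullet>(\<Lambda>\<^sup>0\<^sub>\<gamma>, osp)\<close>, a homology class being the set of its representatives.\<close>

definition prim_homology :: "real \<Rightarrow> (cemon \<Rightarrow>\<^sub>0 real) set set"
  where "prim_homology k =
    {{y \<in> ce_chains k. y - x \<in> null_homologous} | x.
       x \<in> ce_chains k \<and> ce_cycle x \<and> primitive_class x}"


section \<open>The dg Frobenius algebra \<open>\<Xi>\<close>\<close>

text \<open>The pair \<open>(r, s)\<close> is the element \<open>r \<cdot> 1 + s \<cdot> a\<close>.\<close>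

type_synonym xi = "real \<times> real"

definition xi_one :: xi
  where "xi_one = (1, 0)"

definition xi_mult :: "xi \<Rightarrow> xi \<Rightarrow> xi"
  where "xi_mult x y = (fst x * fst y + snd x * snd y, fst x * snd y + snd x * fst y)"

definition xi_d :: "xi \<Rightarrow> xi"
  where "xi_d x = (snd x, 0)"

definition xi_form :: "xi \<Rightarrow> xi \<Rightarrow> real"
  where "xi_form x y = fst x * snd y + snd x * fst y"

definition xi_s :: "xi \<Rightarrow> xi"
  where "xi_s x = (0, fst x)"

datatype xib = One | Aa

fun xpar :: "xib \<Rightarrow> nat" where
  "xpar One = 0"
| "xpar Aa = 1"

fun xvec :: "xib \<Rightarrow> xi" where
  "xvec One = (1, 0)"
| "xvec Aa = (0, 1)"

lemma xi_dg_frobenius: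
  "xi_mult xi_one x = x" "xi_mult x xi_one = x"
  "xi_mult (xi_mult x y) z = xi_mult x (xi_mult y z)"
  "xi_mult (xvec Aa) (xvec Aa) = xi_one" "xi_d (xvec Aa) = xi_one" "xi_d (xi_d x) = 0"
  "xi_d (xi_mult (xvec b) x) = xi_mult (xi_d (xvec b)) x + sg (xpar b) *\<^sub>R xi_mult (xvec b) (xi_d x)"
  "xi_form (xvec Aa) xi_one = 1"
  "xi_form (xvec b) (xvec c) = sg (xpar b * xpar c) * xi_form (xvec c) (xvec b)"
  "xi_form (xi_mult x y) z = xi_form x (xi_mult y z)"
  "xi_form (xi_d (xvec b)) y + sg (xpar b) * xi_form (xvec b) (xi_d y) = 0"
  by (cases b; cases c;
      auto simp: xi_one_def xi_mult_def xi_d_def xi_form_def sg_def prod_eq_iff algebra_simps)+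

lemma xi_hodge:
  "xi_d (xi_s x) + xi_s (xi_d x) = x" "xi_s (xi_s x) = 0"
  "xi_form (xi_s (xvec b)) y = sg (xpar b) * xi_form (xvec b) (xi_s y)"
  "range xi_s = span {xvec Aa}"
proof -
  show "range xi_s = span {xvec Aa}"
    by (auto simp: xi_s_def span_singleton image_iff)
qed (cases b; auto simp: xi_d_def xi_s_def xi_form_def sg_def prod_eq_iff)+

text \<open>The inverse form \<open>x\<^sub>i \<otimes> y\<^sup>i = a \<otimes> 1 - 1 \<otimes> a\<close>, as a list of coefficients and pairs of basis elements.\<close>

definition casimir :: "(real \<times> xib \<times> xib) list"
  where "casimir = [(1, Aa, One), (-1, One, Aa)]"

text \<open>
  The defining property of the inverse form: \<open>D\<^sub>l\<close> and \<open>D\<^sub>r\<close> are odd here, so that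
  \<open>(D\<^sub>l \<otimes> D\<^sub>r)(u \<otimes> v) = (-1)\<^bsup>|u|\<^esup> D\<^sub>l u \<otimes> D\<^sub>r v\<close>.
\<close>

lemma casimir_inverse:
  "(\<Sum>(c, x, y)\<leftarrow>casimir.
      sg (xpar u) * c * (xi_form (xvec u) (xvec x) * xi_form (xvec y) (xvec v)))
    = xi_form (xvec u) (xvec v)"
  by (cases u; cases v) (auto simp: casimir_def xi_form_def sg_def)

lemma xi_beta_zero:
  "(\<Sum>(c, x, y)\<leftarrow>casimir. c *\<^sub>R xi_mult (xvec x) (xi_mult (xvec y) b)) = 0"
  by (auto simp: casimir_def xi_mult_def prod_eq_iff)

definition xi_gamma :: "xi \<Rightarrow> xi"
  where "xi_gamma b =
    (\<Sum>(c, x, y)\<leftarrow>casimir. \<Sum>(c', x', y')\<leftarrow>casimir.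
      (sg (xpar x' * xpar y) * c * c') *\<^sub>R
      xi_mult (xvec x) (xi_mult (xvec x') (xi_mult (xvec y) (xi_mult (xvec y') b))))"

definition tn :: "xi list \<Rightarrow> real"
  where "tn xs = xi_form (foldr xi_mult (butlast xs) xi_one) (last xs)"

fun apply_first :: "('a \<Rightarrow> 'a) \<Rightarrow> 'a list list \<Rightarrow> 'a list list" where
  "apply_first f ((a # w) # ws) = (f a # w) # ws"
| "apply_first f ws = ws"

text \<open>
  \<open>alpha g [w\<^sub>1, \<dots>, w\<^sub>n]\<close> is \<open>\<alpha>\<^sub>n\<^bsup>g,0\<^esup>\<close> on words of basis elements. Words of \<open>\<Lambda>\<^sub>\<gamma>\<close> do not involve \<open>\<nu>\<close>, so
  the functionals with \<open>b > 0\<close> do not occur.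
\<close>

definition alpha :: "nat \<Rightarrow> xib list list \<Rightarrow> real"
  where "alpha g ws =
    (\<Sum>cs\<in>{cs. set cs \<subseteq> set casimir \<and> length cs = length ws}.
      sg (\<Sum>r\<in>{1..<length ws}. xpar (snd (snd (cs ! r))) * (parsum xpar (concat (take r ws)) + r))
      * (\<Prod>(c, x, y)\<leftarrow>cs. c)
      * tn (rev (map (\<lambda>(c, x, y). xvec x) cs))
      * tn (concat (map2 (\<lambda>(c, x, y) w. xvec y # w) cs
              (apply_first (xi_gamma ^^ g) (map (map xvec) ws)))))"


section \<open>The class \<open>Q\<^sub>\<Xi>\<close>\<close>

text \<open>
  The pair \<open>(v, x)\<close> is the coordinate \<open>v \<otimes> x\<^sup>*\<close> on \<open>V \<otimes> \<Xi>\<close> where \<open>x\<^sup>*\<close> belongs to the dual basis.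

  The Koszul sign of \<open>\<Phi>\<close> on \<open>\<Pi>w\<^sub>1 \<cdots> \<Pi>w\<^sub>n \<otimes> \<alpha>\<^sub>n\<close> has three contributions:
  the \<open>n\<close> odd symbols \<open>\<Pi>\<close> are moved to the right, next to \<open>\<alpha>\<^sub>n\<close> (the \<open>r\<close>-th one passes \<open>w\<^sub>r, \<dots>, w\<^sub>n\<close>);
  the letters of the tensor \<open>\<alpha>\<^sub>n\<close> are interleaved with those of \<open>w\<^sub>1 \<otimes> \<dots> \<otimes> w\<^sub>n\<close>;
  and the second of the two odd functionals \<open>t\<close> in \<open>\<alpha>\<^sub>n\<close> passes the arguments \<open>x\<close> of the first one,
  whose total parity is odd whenever the value of the first one is not zero (the summand 1). The last
  sign is needed for \<open>\<Phi>\<close> to be compatible with the brackets of \<open>\<Lambda>\<^sub>\<gamma>\<close>.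
\<close>

definition phi_sign :: "cword list \<Rightarrow> xib list list \<Rightarrow> real"
  where "phi_sign ws ls =
    sg (1 + (\<Sum>r<length ws. Suc r * wpar (ws ! r))
          + (\<Sum>j<length (concat ws). \<Sum>i<j. xpar (concat ls ! i) * cpar (concat ws ! j)))"

fun Phi :: "lmon \<Rightarrow> (nat \<times> (coord \<times> xib) list list \<Rightarrow>\<^sub>0 real)"
  where "Phi (g, ws) =
    (\<Sum>ls\<in>{ls. map length ls = map length ws}.
      Poly_Mapping.single (g, map2 zip ws ls) (phi_sign ws ls * alpha g ls))"

text \<open>
  An element of \<open>\<real>[h]\<close> or \<open>\<real>[h, 1/h]\<close> is treated as a function of \<open>h > 0\<close>; this is also what gives a
  meaning to the integrals. A list of coordinates stands for their product in \<open>S((V \<otimes> \<Xi>)\<^sup>*)\<close>.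
\<close>

fun Nmap :: "real \<Rightarrow> nat \<times> (coord \<times> xib) list list \<Rightarrow> ((coord \<times> xib) list \<Rightarrow>\<^sub>0 real)"
  where "Nmap h (i, ws) = Poly_Mapping.single (concat ws) (h ^ (2 * i + length ws - 1))"

fun MNPhi :: "real \<Rightarrow> cemon \<Rightarrow> ((coord \<times> xib) list \<Rightarrow>\<^sub>0 real)" where
  "MNPhi h [] = single1 []"
| "MNPhi h (f # m) =
    lext (\<lambda>(l, l'). Poly_Mapping.single (l @ l') (1 / h))
      (tens (lext (Nmap h) (Phi f)) (MNPhi h m))"

text \<open>
  The even symmetric form on \<open>V \<otimes> \<Xi>\<close> to which \<open>\<sigma>\<^sub>d\<close> corresponds, on basis vectors. By symmetry
  \<open>\<sigma>\<^sub>d = 1/2 \<cdot> \<Sum> F(b,b') \<cdot> b\<^sup>* b'\<^sup>*\<close>. On the subspace \<open>V \<otimes> Im(s)\<close>, where \<open>Im(s)\<close> is spanned by \<open>a\<close>, this is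
  \<open>\<Sum> F(\<xi>\<^sub>i,\<xi>\<^sub>i)/2 \<cdot> \<xi>\<^sub>i\<^sup>2 + \<Sum> F(p\<^sub>i,q\<^sub>i) \<cdot> p\<^sub>i q\<^sub>i\<close>, writing \<open>\<xi>\<^sub>i\<close> for \<open>\<xi>\<^sub>i \<otimes> a\<^sup>*\<close> and so on. Tensoring with the odd
  \<open>a\<close> exchanges parities: \<open>\<xi>\<^sub>i\<close> is even and \<open>p\<^sub>i, q\<^sub>i\<close> are odd there.
\<close>

definition sigma_form :: "coord \<times> xib \<Rightarrow> coord \<times> xib \<Rightarrow> real"
  where "sigma_form = (\<lambda>(v, x) (v', x').
    sg (xpar x * (cpar v' + 1)) * omega v v' * xi_form (xvec x) (xi_d (xvec x')))"

abbreviation sigmaL :: "coord \<Rightarrow> coord \<Rightarrow> real"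
  where "sigmaL v v' \<equiv> sigma_form (v, Aa) (v', Aa)"

text \<open>Since \<open>F(\<xi>\<^sub>i,\<xi>\<^sub>i) = 1\<close> is positive, no Wick rotation is necessary.\<close>

definition gauss :: "real \<Rightarrow> real \<Rightarrow> nat \<Rightarrow> real"
  where "gauss h c k = (LBINT u. u ^ k * exp (- (c * u\<^sup>2) / h))"

fun berezin_index :: "coord \<Rightarrow> nat" where
  "berezin_index (Cp i) = 2 * i"
| "berezin_index (Cq i) = 2 * i + 1"
| "berezin_index (Cxi i) = 0"

text \<open>The Berezin integral over \<open>p\<^sub>0, q\<^sub>0, \<dots>, p\<^bsub>n-1\<^esub>, q\<^bsub>n-1\<^esub>\<close> (normalized to be 1 on their product in this order).\<close>

definition berezin :: "nat \<Rightarrow> coord list \<Rightarrow> real"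
  where "berezin n l =
    (if distinct l \<and> set l = W n 0
     then sg (card {(i, j). i < j \<and> j < length l \<and> berezin_index (l ! j) < berezin_index (l ! i)})
     else 0)"

text \<open>The Berezin integral of \<open>l \<cdot> exp(-\<sigma>/h)\<close>; the exponential series ends after the \<open>n\<close>-th power.\<close>

definition berezin_exp :: "nat \<Rightarrow> real \<Rightarrow> coord list \<Rightarrow> real"
  where "berezin_exp n h l =
    (\<Sum>k\<le>n. \<Sum>is\<in>{is. set is \<subseteq> {..<n} \<and> length is = k}.
      (1 / fact k) * (\<Prod>i\<leftarrow>is. - sigmaL (Cp i) (Cq i) / h)
      * berezin n (l @ concat (map (\<lambda>i. [Cp i, Cq i]) is)))"

text \<open>
  The integral over \<open>V \<otimes> Im(s)\<close>, for \<open>V\<close> of dimension \<open>2n|m\<close>, of a product of coordinates times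
  \<open>exp(-\<sigma>\<^sub>d/h)\<close>. The coordinates \<open>v \<otimes> 1\<^sup>*\<close> vanish on this subspace.
\<close>

definition integral_L :: "nat \<Rightarrow> nat \<Rightarrow> real \<Rightarrow> (coord \<times> xib) list \<Rightarrow> real"
  where "integral_L n m h l =
    (if \<forall>b\<in>set l. snd b = Aa
     then (\<Prod>j<m. gauss h (sigmaL (Cxi j) (Cxi j) / 2) (count_list (map fst l) (Cxi j)))
          * berezin_exp n h (filter (\<lambda>v. cpar v = 0) (map fst l))
     else 0)"

definition Q_fin :: "nat \<Rightarrow> nat \<Rightarrow> real \<Rightarrow> cemon \<Rightarrow> real"
  where "Q_fin n m h x = lext (integral_L n m h) (MNPhi h x) / integral_L n m h []"

text \<open>
  On the limit: a monomial is evaluated at the first stage \<open>W n m\<close> of the direct system at which it is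
  defined. The value at all later stages is the same.

  As \<open>Q\<^sub>\<Xi>\<close> is a cocycle of the relative complex, its values on all representatives of a homology class
  agree; the component of \<open>Q\<^sub>\<Xi>\<close> in Euler characteristic \<open>\<chi>\<close> is the functional it induces on
  \<open>prim_homology (-\<chi>)\<close>.
\<close>

definition ce_letters :: "cemon \<Rightarrow> coord set"
  where "ce_letters x = set (concat (concat (map snd x)))"

definition Q_Xi :: "real \<Rightarrow> (cemon \<Rightarrow>\<^sub>0 real) \<Rightarrow> real"
  where "Q_Xi h = lext (\<lambda>x.
    Q_fin (LEAST n. \<exists>m. ce_letters x \<subseteq> W n m) (LEAST m. \<exists>n. ce_letters x \<subseteq> W n m) h x)"

end

theory Submission
  imports Defs "HOL-Probability.Distributions"
begin

text \<open>
  A Chevalley-Eilenberg monomial with a single factor is primitive, so it suffices to evaluate \<open>Q\<close> on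
  cycles of this form. Let \<open>\<xi>\<close> be an odd coordinate. For \<open>\<chi> = -2g - 1\<close> take \<open>\<gamma>\<^sup>g [\<xi>][\<xi>]\<close>, whose differential
  consists of terms containing the empty word. For \<open>\<chi> = -2g - 2\<close> take \<open>\<gamma>\<^sup>g [\<xi>][\<xi>\<xi>\<xi>]\<close>; up to terms with the
  empty word its differential is a multiple of \<open>\<gamma>\<^bsup>g+1\<^esup> [\<xi>\<xi>]\<close>, which vanishes since exchanging two odd
  letters cyclically changes the sign. On \<open>V \<otimes> Im(s)\<close> both give \<open>\<alpha>\<^sub>2\<^bsup>g,0\<^esup>\<close> on words in \<open>a\<close> times an even
  power of one even variable. The former is \<open>-2\<^bsup>g+1\<^esup>\<close> because the map \<open>\<gamma>\<close> of \<open>\<Xi>\<close> is multiplication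
  by 2, and even Gaussian moments are positive.
\<close>

section \<open>Linear extensions\<close>

lemma lext_supset:
  assumes "finite K" "Poly_Mapping.keys x \<subseteq> K"
  shows "lext f x = (\<Sum>k\<in>K. Poly_Mapping.lookup x k *\<^sub>R f k)"
  unfolding lext_def
  by (rule sum.mono_neutral_left) (use assms in \<open>auto simp: in_keys_iff\<close>)

lemma lext_add: "lext f (x + y) = lext f x + lext f y"
proof -
  let ?K = "Poly_Mapping.keys x \<union> Poly_Mapping.keys y"
  have "lext f z = (\<Sum>k\<in>?K. Poly_Mapping.lookup z k *\<^sub>R f k)"
    if "Poly_Mapping.keys z \<subseteq> ?K" for z
    by (rule lext_supset) (use that in auto)
  then show ?thesis
    using Poly_Mapping.keys_add[of x y]
    by (simp add: lookup_add scaleR_add_left sum.distrib)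
qed

lemma lext_scaleR: "lext f (r *\<^sub>R x) = r *\<^sub>R lext f x"
proof -
  have "Poly_Mapping.keys (r *\<^sub>R x) \<subseteq> Poly_Mapping.keys x"
    by (auto simp: in_keys_iff)
  then have "lext f (r *\<^sub>R x)
      = (\<Sum>k\<in>Poly_Mapping.keys x. Poly_Mapping.lookup (r *\<^sub>R x) k *\<^sub>R f k)"
    by (intro lext_supset) auto
  then show ?thesis
    by (simp add: lext_def scaleR_sum_right)
qed

lemma linear_lext: "linear (lext f)"
  by (rule linearI) (simp_all add: lext_add lext_scaleR)

lemma lext_zero [simp]: "lext f 0 = 0"
  by (simp add: lext_def)

lemma lext_single [simp]: "lext f (Poly_Mapping.single k c) = c *\<^sub>R f k"
  by (simp add: lext_def)

lemma lext_sum: "lext f (sum g A) = (\<Sum>a\<in>A. lext f (g a))"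
  by (rule linear_sum[OF linear_lext])

lemma lext_diff: "lext f (x - y) = lext f x - lext f y"
  by (rule linear_diff[OF linear_lext])

lemma scaleR_single: "r *\<^sub>R Poly_Mapping.single k c = Poly_Mapping.single k (r * c)"
  for c :: real
  by (rule poly_mapping_eqI) (simp add: lookup_single when_def)

lemma tens_single1 [simp]: "tens (single1 m) (single1 m') = single1 (m, m')"
  by (simp add: tens_def)

section \<open>Primitive cycles with a single factor\<close>

text \<open>A single factor admits only the two trivial unshuffles, so the reduced coproduct is 0
  before any quotient is taken.\<close>

lemma primitive_class_single: "primitive_class (single1 [f])"
proof -
  have "Pow {..<length [f]} = {{}, {0}}"
    by (auto simp: lessThan_Suc)
  then have "coprod [f] = single1 ([], [f]) + single1 ([f], [])"
    by (simp add: coprod_def sg_def)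
  then show ?thesis
    by (simp add: primitive_class_def span_zero)
qed

text \<open>Rotating \<open>[Cxi i, Cxi i]\<close> costs the sign -1, so the cyclic relation reads
  \<open>?y + ?y\<close>; over the reals \<open>?y\<close> itself is then a relation.\<close>

lemma ce_cycle_single:
  assumes "lie_diff f = c *\<^sub>R single1 (g, [[Cxi i, Cxi i]])" "g > 0"
  shows "ce_cycle (single1 [f])"
proof -
  let ?y = "single1 [(g, [[Cxi i, Cxi i]])]"
  have "?y - sg (cpar (Cxi i) * wpar [Cxi i]) *\<^sub>R ?y \<in> relators"
    unfolding relators_def
    apply (intro UnI1 CollectI)
    apply (rule exI[of _ "[]"], rule exI[of _ g], rule exI[of _ "[]"], rule exI[of _ "Cxi i"],
        rule exI[of _ "[Cxi i]"], rule exI[of _ "[]"], rule exI[of _ "[]"])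
    by (use assms in \<open>simp add: ce_mons_def\<close>)
  then have "2 *\<^sub>R ?y \<in> relations"
    by (simp add: relations_def parsum_def sg_def span_base scaleR_2)
  then have "(c / 2) *\<^sub>R (2 *\<^sub>R ?y) \<in> relations"
    unfolding relations_def by (rule span_scale)
  moreover have "ce_diff [f] = c *\<^sub>R ?y"
    using assms by (simp add: ce_diff_def front1_def parsum_def sg_def omit1_def lext_scaleR)
  ultimately show ?thesis
    by (simp add: ce_cycle_def)
qed

lemma lie_diff_1_1:
  "lie_diff (g, [[Cxi 0], [Cxi 0]]) = 0"
  by (simp add: lessThan_Suc odd_bracket_words_def bracket_words_def odd_cobracket_word_def
      cobracket_word_def lext_scaleR omit2_def)

text \<open>The bracket of the two words leaves two letters. Contracting two of three letters leaves
  one, so every cobracket term contains an empty word and is dropped by \<open>mono\<close>.\<close>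

lemma lie_diff_1_3:
  "\<exists>c. lie_diff (g, [[Cxi 0], [Cxi 0, Cxi 0, Cxi 0]]) = c *\<^sub>R single1 (Suc g, [[Cxi 0, Cxi 0]])"
  by (simp add: lessThan_Suc numeral_eq_Suc odd_bracket_words_def bracket_words_def odd_cobracket_word_def
      cobracket_word_def lext_scaleR lext_add lext_diff omit2_def omit1_def Let_def scaleR_single
      single_add[symmetric]) blast

section \<open>Values of \<open>alpha\<close> on words in \<open>Aa\<close>\<close>

lemma xi_gamma: "xi_gamma b = 2 *\<^sub>R b"
  by (simp add: xi_gamma_def casimir_def xi_mult_def sg_def prod_eq_iff)

lemma xi_gamma_power: "(xi_gamma ^^ g) b = 2 ^ g *\<^sub>R b"
  by (induction g) (simp_all add: xi_gamma)

lemma lists_length_2_of_pair: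
  "{cs. set cs \<subseteq> {a, b} \<and> length cs = Suc (Suc 0)} = {[a, a], [a, b], [b, a], [b, b]}"
  by (auto simp: length_Suc_conv)

lemma casimir_pairs:
  "{cs. set cs \<subseteq> set casimir \<and> length cs = Suc (Suc 0)} =
    {[(1, Aa, One), (1, Aa, One)], [(1, Aa, One), (-1, One, Aa)],
     [(-1, One, Aa), (1, Aa, One)], [(-1, One, Aa), (-1, One, Aa)]}"
  unfolding casimir_def list.set by (simp add: lists_length_2_of_pair)

text \<open>The first \<open>tn\<close> vanishes unless exactly one of the two entries
  \<open>x\<close> is \<open>Aa\<close>; the two remaining choices contribute
  \<open>- (2 ^ g)\<close> each.\<close>

lemma alpha_1_1: "alpha g [[Aa], [Aa]] = - (2 ^ Suc g)"
  by (simp add: alpha_def casimir_pairs xi_gamma_power tn_def xi_mult_def xi_form_def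
      xi_one_def parsum_def sg_def)

text \<open>The two extra letters multiply to 1, and the sign exponent sees only the first
  word.\<close>

lemma alpha_1_3: "alpha g [[Aa], [Aa, Aa, Aa]] = - (2 ^ Suc g)"
  by (simp add: alpha_def casimir_pairs xi_gamma_power tn_def xi_mult_def xi_form_def
      xi_one_def parsum_def sg_def)

section \<open>Evaluation of the integral\<close>

text \<open>The weight is \<open>sqrt (2 * pi)\<close> times the standard normal density, whose even
  moments are positive.\<close>

lemma gauss_even_pos: "gauss 1 (1 / 2) (2 * k) > 0"
proof -
  have "has_bochner_integral lborel (\<lambda>u. sqrt (2 * pi) * (std_normal_density u * u ^ (2 * k)))
      (sqrt (2 * pi) * (fact (2 * k) / (2 ^ k * fact k)))"
    by (intro has_bochner_integral_mult_right std_normal_moment_even)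
  also have "(\<lambda>u. sqrt (2 * pi) * (std_normal_density u * u ^ (2 * k)))
      = (\<lambda>u. u ^ (2 * k) * exp (- (1 / 2 * u\<^sup>2) / 1))"
    by (simp add: std_normal_density_def fun_eq_iff)
  finally show ?thesis
    by (simp add: gauss_def has_bochner_integral_integral_eq)
qed

lemma finite_map_length_eq: "finite {ls :: 'a::finite list list. map length ls = ns}"
proof (rule finite_subset)
  let ?L = "{l :: 'a list. set l \<subseteq> UNIV \<and> length l \<le> sum_list ns}"
  show "{ls. map length ls = ns} \<subseteq> {ls. set ls \<subseteq> ?L \<and> length ls = length ns}"
    by (auto intro!: member_le_sum_list)
  show "finite {ls. set ls \<subseteq> ?L \<and> length ls = length ns}"
    by (intro finite_lists_length_eq finite_lists_length_le) simp
qed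

instance xib :: finite
proof
  show "finite (UNIV :: xib set)"
    by (rule finite_subset[of _ "{One, Aa}"]) (use xib.exhaust in auto)
qed

lemma concat_map2_zip:
  assumes "map length ls = map length ws"
  shows "map fst (concat (map2 zip ws ls)) = concat ws"
    and "map snd (concat (map2 zip ws ls)) = concat ls"
proof -
  have "length ws = length ls"
    using assms map_eq_imp_length_eq by metis
  then show "map fst (concat (map2 zip ws ls)) = concat ws"
    and "map snd (concat (map2 zip ws ls)) = concat ls"
    using assms by (induction ws ls rule: list_induct2) auto
qed

text \<open>With \<open>c = Aa\<close> this identifies the only labelling in \<open>Phi\<close> that
  survives on V \<otimes> Im(s), where the coordinates labelled \<open>One\<close> vanish.\<close>

lemma constant_lists:
  assumes "map length ls = map length ws" "\<forall>x\<in>set (concat ls). x = c"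
  shows "ls = map (map (\<lambda>_. c)) ws"
proof -
  have "map (\<lambda>_. c) l = l" if "l \<in> set ls" for l
    by (rule map_idI) (use assms(2) that in auto)
  then have "ls = map (map (\<lambda>_. c)) ls"
    by (simp add: map_idI)
  also have "\<dots> = map (\<lambda>n. replicate n c) (map length ls)"
    by (simp add: map_replicate_const)
  also have "\<dots> = map (map (\<lambda>_. c)) ws"
    unfolding assms(1) by (simp add: map_replicate_const)
  finally show ?thesis .
qed

text \<open>For V of dimension 0|1 the domain is a line with one even coordinate, and the Berezin
  factor is empty.\<close>

lemma integral_L_0_1:
  assumes "\<forall>b\<in>set l. b = (Cxi 0, Aa)"
  shows "integral_L 0 1 h l = gauss h (1 / 2) (length l)"
proof -
  have l: "l = replicate (length l) (Cxi 0, Aa)"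
    using assms by (intro replicate_eqI) auto
  have "count_list (replicate n (Cxi 0)) (Cxi 0) = n" for n
    by (induction n) auto
  moreover have "berezin_exp 0 h [] = 1"
    by (simp add: berezin_exp_def berezin_def W_def sg_def)
  ultimately show ?thesis
    by (subst l)
      (simp add: integral_L_def sigma_form_def xi_form_def xi_d_def sg_def filter_replicate)
qed

lemma lext_MNPhi_single:
  "lext F (MNPhi h [(g, ws)]) =
    (\<Sum>ls\<in>{ls. map length ls = map length ws}.
      (phi_sign ws ls * alpha g ls * h ^ (2 * g + length (map2 zip ws ls) - 1) / h)
      *\<^sub>R F (concat (map2 zip ws ls)))"
  by (simp add: tens_def lext_sum scaleR_single)

lemma Q_fin_single:
  assumes "\<forall>v\<in>set (concat ws). v = Cxi 0"
  shows "Q_fin 0 1 1 [(g, ws)] =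
    phi_sign ws (map (map (\<lambda>_. Aa)) ws) * alpha g (map (map (\<lambda>_. Aa)) ws)
      * gauss 1 (1 / 2) (length (concat ws)) / gauss 1 (1 / 2) 0"
proof -
  let ?A = "map (map (\<lambda>_. Aa)) ws"
  let ?S = "{ls. map length ls = map length ws}"
  let ?c = "\<lambda>ls. phi_sign ws ls * alpha g ls"
  have A: "?A \<in> ?S"
    by simp
  have zero: "integral_L 0 1 1 (concat (map2 zip ws ls)) = 0" if "ls \<in> ?S - {?A}" for ls
  proof -
    have "\<not> (\<forall>x\<in>set (concat ls). x = Aa)"
    proof
      assume "\<forall>x\<in>set (concat ls). x = Aa"
      with that have "ls = ?A"
        by (intro constant_lists) simp_all
      with that show False
        by simp
    qed
    moreover have "set (concat ls) = snd ` set (concat (map2 zip ws ls))"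
      using that concat_map2_zip(2)[of ls ws] by (metis (mono_tags) DiffD1 list.set_map mem_Collect_eq)
    ultimately have "\<not> (\<forall>b\<in>set (concat (map2 zip ws ls)). snd b = Aa)"
      by (simp only: ball_simps)
    then show ?thesis
      by (simp only: integral_L_def if_False)
  qed
  have letters: "\<forall>b\<in>set (concat (map2 zip ws ?A)). b = (Cxi 0, Aa)"
  proof
    fix b assume b: "b \<in> set (concat (map2 zip ws ?A))"
    have "fst b \<in> set (map fst (concat (map2 zip ws ?A)))"
      and "snd b \<in> set (map snd (concat (map2 zip ws ?A)))"
      using b by (simp_all del: set_concat)
    then have "fst b \<in> set (concat ws)" "snd b \<in> set (concat ?A)"
      using concat_map2_zip[of ?A ws] by (simp_all del: set_concat)
    then show "b = (Cxi 0, Aa)"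
      using assms by (auto simp: prod_eq_iff)
  qed
  have len: "length (concat (map2 zip ws ?A)) = length (concat ws)"
    using arg_cong[OF concat_map2_zip(1)[of ?A ws], of length]
    by (simp del: length_concat)
  \<comment> \<open>At h = 1 all powers of h from \<open>Nmap\<close> and \<open>MNPhi\<close> are
    1.\<close>
  have "lext (integral_L 0 1 1) (MNPhi 1 [(g, ws)])
      = (\<Sum>ls\<in>?S. ?c ls * integral_L 0 1 1 (concat (map2 zip ws ls)))"
    unfolding lext_MNPhi_single by simp
  also have "\<dots> = (\<Sum>ls\<in>{?A}. ?c ls * integral_L 0 1 1 (concat (map2 zip ws ls)))"
    using A zero by (intro sum.mono_neutral_right) (auto simp: finite_map_length_eq)
  also have "\<dots> = ?c ?A * gauss 1 (1 / 2) (length (concat ws))"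
    using integral_L_0_1[OF letters] len by simp
  finally show ?thesis
    using integral_L_0_1[of "[]"] by (simp add: Q_fin_def)
qed

section \<open>Nonvanishing in every weight\<close>

lemma Q_Xi_nonzero:
  assumes "set (concat ws) = {Cxi 0}" "even (length (concat ws))"
    and "alpha g (map (map (\<lambda>_. Aa)) ws) \<noteq> 0"
  shows "Q_Xi 1 (single1 [(g, ws)]) \<noteq> 0"
proof -
  have letters: "ce_letters [(g, ws)] = {Cxi 0}"
    using assms by (simp add: ce_letters_def)
  \<comment> \<open>The letter \<open>Cxi 0\<close> first appears in \<open>W 0 1\<close>.\<close>
  have n: "(LEAST n. \<exists>m. {Cxi 0} \<subseteq> W n m) = 0"
    by (rule Least_equality) (auto simp: W_def)
  have m: "(LEAST m. \<exists>n. {Cxi 0} \<subseteq> W n m) = 1"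
    by (rule Least_equality) (auto simp: W_def image_iff intro!: Suc_leI)
  obtain k where "length (concat ws) = 2 * k"
    using assms(2) by (rule evenE)
  moreover have "gauss 1 (1 / 2) (2 * k) > 0" "gauss 1 (1 / 2) 0 > 0"
    using gauss_even_pos[of k] gauss_even_pos[of 0] by simp_all
  moreover have "phi_sign ws (map (map (\<lambda>_. Aa)) ws) \<noteq> 0"
    by (simp add: phi_sign_def sg_def)
  ultimately have "Q_fin 0 1 1 [(g, ws)] \<noteq> 0"
    using assms Q_fin_single[of ws g] by simp
  then show ?thesis
    by (simp add: Q_Xi_def letters n[simplified] m[simplified])
qed

lemma prim_homology_single:
  assumes "ce_cycle (single1 [f])" "in_Lambda f" "ce_weight [f] = k"
  shows "\<exists>X\<in>prim_homology k. single1 [f] \<in> X"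
proof -
  have chain: "single1 [f] \<in> ce_chains k"
    using assms by (simp add: ce_chains_def ce_mons_def)
  then have "{y \<in> ce_chains k. y - single1 [f] \<in> null_homologous} \<in> prim_homology k"
    unfolding prim_homology_def using assms primitive_class_single by blast
  then show ?thesis
    by (rule rev_bexI) (simp add: chain null_homologous_def span_zero)
qed

theorem proposition8p1:
  fixes chi :: int
  assumes "chi \<le> -1"
  shows "\<exists>X\<in>prim_homology (- real_of_int chi). \<exists>x\<in>X. \<exists>h>0. Q_Xi h x \<noteq> 0"
proof -
  let ?z = "Cxi 0"
  obtain f where f: "ce_cycle (single1 [f])" "in_Lambda f" "ce_weight [f] = - real_of_int chi"
    "Q_Xi 1 (single1 [f]) \<noteq> 0"
  proof (cases "even chi")
    case False
    then obtain b where b: "chi = 2 * b + 1"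
      by (rule oddE)
    \<comment> \<open>The weight 2g + 2 - 2 + 2/2 = 2g + 1 must equal -2b - 1; here b \<le>
      -1.\<close>
    define g where "g = nat (- b - 1)"
    have g: "chi = - 2 * int g - 1"
      using assms b by (simp add: g_def)
    show thesis
    proof (rule that[of "(g, [[?z], [?z]])"])
      show "ce_cycle (single1 [(g, [[?z], [?z]])])"
        \<comment> \<open>The coefficient is 0, so any positive exponent serves for the
          target.\<close>
        using ce_cycle_single[of _ 0 1] lie_diff_1_1 by simp
      show "Q_Xi 1 (single1 [(g, [[?z], [?z]])]) \<noteq> 0"
        using alpha_1_1 by (intro Q_Xi_nonzero) simp_all
    qed (simp_all add: ce_weight_def g)
  next
    case True
    then obtain b where b: "chi = 2 * b"
      by (rule evenE)
    \<comment> \<open>The weight is now 2g + 2 - 2 + 4/2 = 2g + 2 and must equal -2b; parity again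
      gives b \<le> -1.\<close>
    define g where "g = nat (- b - 1)"
    have g: "chi = - 2 * int g - 2"
      using assms b by (simp add: g_def)
    show thesis
    proof (rule that[of "(g, [[?z], [?z, ?z, ?z]])"])
      show "ce_cycle (single1 [(g, [[?z], [?z, ?z, ?z]])])"
        using lie_diff_1_3[of g] ce_cycle_single[of _ _ "Suc g"] by blast
      show "Q_Xi 1 (single1 [(g, [[?z], [?z, ?z, ?z]])]) \<noteq> 0"
        using alpha_1_3 by (intro Q_Xi_nonzero) simp_all
    qed (simp_all add: ce_weight_def g)
  qed
  then show ?thesis
    using prim_homology_single[of f] zero_less_one by metis
qed

end
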